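(* Let $0\le q<1$ and $p\in[-\infty,\infty]$. For fixed $y>0$ the ratio $A_p(x,y)/St_q(x,y)$ is increasing in $x$ for $x\ge y$ if and only if $p\ge\max\{q,(1+q)/3\}$. In particular, $A_p(x,y)\ge St_q(x,y)$ for all $x,y\in[0,\infty)$ for the same $p$ and $q$ (i.e. whenever $p\ge\max\{q,(1+q)/3\}$).
   Context: "Increasing" is non-strict. For $x,y\ge0$ the power mean is $A_p(x,y)=\left(\frac{x^p+y^p}{2}\right)^{1/p}$ for $p\in\mathbb{R}\setminus\{0\}$, $A_0(x,y)=\sqrt{xy}$, $A_{-\infty}(x,y)=\min\{x,y\}$, $A_\infty(x,y)=\max\{x,y\}$, with $A_p(x,0)=A_p(0,x)=0$ for $p\le0$. The Stolarsky mean is, for $x\neq y$ in $[0,\infty)$, $St_q(x,y)=\left(\frac{x^q-y^q}{q(x-y)}\right)^{1/(q-1)}$ for $0<q<1$, and $St_0(x,y)=L(x,y)=\frac{x-y}{\log x-\log y}$ for $x,y>0$, $L(x,0)=L(0,x)=0$; on the diagonal $St_q(x,x)=x$. *)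

theory Defs
  imports "HOL-Analysis.Analysis" "HOL-Library.Extended_Real"
begin

(* Both means are meant for x, y >= 0 only.  The zero-argument cases are split off explicitly
   because "0 powr a = 0" and "ln 0 = 0" are library conventions that would give other values.
   The order p ranges over the extended reals, so p = \<infinity> and p = -\<infinity> are included. *)

definition power_mean :: "ereal \<Rightarrow> real \<Rightarrow> real \<Rightarrow> real" where
  "power_mean p x y =
     (if p = \<infinity> then max x y
      else if p = -\<infinity> then min x y
      else if p = 0 then sqrt (x * y)
      else if p < 0 \<and> (x = 0 \<or> y = 0) then 0
      else ((x powr real_of_ereal p + y powr real_of_ereal p) / 2) powr (1 / real_of_ereal p))"

definition log_mean :: "real \<Rightarrow> real \<Rightarrow> real" where
  "log_mean x y =
     (if x = y then x
      else if x = 0 \<or> y = 0 then 0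
      else (x - y) / (ln x - ln y))"

(* Only meaningful for 0 <= q < 1. *)
definition stolarsky_mean :: "real \<Rightarrow> real \<Rightarrow> real \<Rightarrow> real" where
  "stolarsky_mean q x y =
     (if x = y then x
      else if q = 0 then log_mean x y
      else ((x powr q - y powr q) / (q * (x - y))) powr (1 / (q - 1)))"

end

theory Submission
  imports Defs "HOL-Real_Asymp.Real_Asymp"
begin

text \<open>
  Substitute \<open>x = y exp(2s)\<close>. Then the means become \<open>y exp s cosh(ps)^(1/p)\<close> and
  \<open>y exp s (q sinh s / sinh(qs))^(1/(1-q))\<close>, so the logarithm of their ratio has derivative
  \<open>tanh(ps) - (coth s - q coth(qs)) / (1 - q)\<close> in \<open>s\<close>, and monotonicity means that this is
  nonnegative for all \<open>s > 0\<close>. The limit \<open>s \<rightarrow> 0\<close> forces \<open>p \<ge> (1 + q)/3\<close>, and \<open>s \<rightarrow> \<infinity>\<close> forces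
  \<open>p \<ge> q\<close>. Conversely, after multiplying out the denominators, the inequality reads
  \<open>q sinh((1-q+p)s) + sinh((1-q-p)s) \<ge> (1-q) sinh((1+q-p)s)\<close>. At the critical \<open>p\<close> all
  coefficients of the power series of the difference are nonnegative; larger \<open>p\<close> follow since
  \<open>tanh\<close> is increasing, and \<open>q = 0\<close> is the limit \<open>q \<rightarrow> 0\<close>.
\<close>

section \<open>Both means in the exponential coordinate\<close>

text \<open>For \<open>s \<ge> 0\<close> this is the logarithm of the power mean of
  \<open>exp s\<close> and \<open>exp (- s)\<close>. At infinite order it is \<open>s\<close> or
  \<open>- s\<close> rather than \<open>\<bar>s\<bar>\<close> or its negative, so it is
  differentiable at 0 too.\<close>

definition log_pow :: "ereal \<Rightarrow> real \<Rightarrow> real" where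
  "log_pow p s =
     (if p = \<infinity> then s else if p = -\<infinity> then - s else if p = 0 then 0
      else ln (cosh (real_of_ereal p * s)) / real_of_ereal p)"

lemma log_pow_0 [simp]: "log_pow p 0 = 0"
  by (auto simp: log_pow_def)

definition pow_slope :: "ereal \<Rightarrow> real \<Rightarrow> real" where
  "pow_slope p s =
     (if p = \<infinity> then 1 else if p = -\<infinity> then -1 else tanh (real_of_ereal p * s))"

text \<open>The logarithm of the Stolarsky mean of \<open>exp s\<close> and \<open>exp (- s)\<close>
  for \<open>s > 0\<close>. At \<open>q = 0\<close> the quotient \<open>sinh (q * s) / q\<close> is
  replaced by its limit \<open>s\<close>.\<close>

definition log_stol :: "real \<Rightarrow> real \<Rightarrow> real" where
  "log_stol q s = (ln (sinh s) - ln (if q = 0 then s else sinh (q * s) / q)) / (1 - q)"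

definition stol_slope :: "real \<Rightarrow> real \<Rightarrow> real" where
  "stol_slope q s =
     (cosh s / sinh s - (if q = 0 then 1 / s else q * cosh (q * s) / sinh (q * s))) / (1 - q)"

text \<open>With \<open>g = y * exp s\<close>, the geometric mean of the two arguments, these are
  \<open>g * exp s\<close> and \<open>g * exp (- s)\<close>. Sums and differences of powers thus
  become \<open>cosh\<close> and \<open>sinh\<close> times a power of \<open>g\<close>.\<close>

lemma powr_exp_arg:
  fixes y s r :: real
  assumes "0 < y"
  shows "(y * exp (2 * s)) powr r = exp (r * (ln y + s)) * exp (r * s)"
    and "y powr r = exp (r * (ln y + s)) * exp (- (r * s))"
proof -
  have "(y * exp (2 * s)) powr r = exp (r * (ln y + s) + r * s)"
    using assms by (simp add: powr_def ln_mult algebra_simps)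
  then show "(y * exp (2 * s)) powr r = exp (r * (ln y + s)) * exp (r * s)"
    by (simp only: exp_add)
  have "r * (ln y + s) + - (r * s) = r * ln y"
    by (simp add: algebra_simps)
  then have "y powr r = exp (r * (ln y + s) + - (r * s))"
    using assms by (simp only: powr_def) simp
  then show "y powr r = exp (r * (ln y + s)) * exp (- (r * s))"
    by (simp only: exp_add)
qed

lemma power_mean_exp:
  assumes "0 < y" "0 \<le> s"
  shows "power_mean p (y * exp (2 * s)) y = y * exp (s + log_pow p s)"
proof -
  consider "p = \<infinity>" | "p = -\<infinity>" | "p = 0" | r where "p = ereal r" "r \<noteq> 0"
    by (cases p) (auto simp: zero_ereal_def)
  then show ?thesis
  proof cases
    case 1
    then show ?thesis using assms by (simp add: power_mean_def log_pow_def max_def)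
  next
    case 2
    then show ?thesis using assms by (simp add: power_mean_def log_pow_def min_def)
  next
    case 3
    have "sqrt (y * exp (2 * s) * y) = y * exp s"
      using assms by (intro real_sqrt_unique) (auto simp: power2_eq_square mult_ac simp flip: exp_add)
    then show ?thesis using 3 by (simp add: power_mean_def log_pow_def)
  next
    case 4
    have "((y * exp (2 * s)) powr r + y powr r) / 2 = exp (r * (ln y + s)) * cosh (r * s)"
      unfolding powr_exp_arg[OF assms(1), where r = r and s = s] cosh_field_def by (simp add: algebra_simps)
    also have "\<dots> = exp (r * (ln y + s) + ln (cosh (r * s)))"
      by (simp add: exp_add)
    finally have "((y * exp (2 * s)) powr r + y powr r) / 2 = exp (r * (ln y + s) + ln (cosh (r * s)))" .
    then have "power_mean p (y * exp (2 * s)) y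
        = exp ((r * (ln y + s) + ln (cosh (r * s))) * (1 / r))"
      using 4 assms(1) by (simp add: power_mean_def exp_powr_real)
    also have "(r * (ln y + s) + ln (cosh (r * s))) * (1 / r) = ln y + (s + log_pow p s)"
      using 4 by (simp add: log_pow_def field_simps)
    finally show ?thesis using assms(1) by (simp add: exp_add)
  qed
qed

lemma stolarsky_mean_exp:
  assumes "0 < y" "0 < s" "0 \<le> q" "q < 1"
  shows "stolarsky_mean q (y * exp (2 * s)) y = y * exp (s + log_stol q s)"
proof -
  let ?x = "y * exp (2 * s)"
  have ne: "?x \<noteq> y" using assms by simp
  have diff: "?x powr r - y powr r = 2 * exp (r * (ln y + s)) * sinh (r * s)" for r
    unfolding powr_exp_arg[OF assms(1), where r = r and s = s] sinh_field_def by (simp add: algebra_simps)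
  have "?x - y = 2 * exp (ln y + s) * sinh s"
    using diff[of 1] assms by simp
  show ?thesis
  proof (cases "q = 0")
    case True
    have "ln ?x - ln y = 2 * s" using assms by (simp add: ln_mult)
    then have "stolarsky_mean q ?x y = exp (ln y + s) * (sinh s / s)"
      using ne assms True \<open>?x - y = _\<close> by (simp add: stolarsky_mean_def log_mean_def)
    also have "sinh s / s = exp (log_stol q s)"
      using assms True by (simp add: log_stol_def exp_diff)
    finally show ?thesis using assms by (simp add: exp_add)
  next
    case False
    then have q: "0 < q" using assms by simp
    have "(?x powr q - y powr q) / (q * (?x - y))
        = exp (q * (ln y + s)) * (sinh (q * s) / q) / (exp (ln y + s) * sinh s)"
      unfolding diff \<open>?x - y = _\<close> by simp
    also have "\<dots> = exp (q * (ln y + s) + ln (sinh (q * s) / q) - (ln y + s) - ln (sinh s))"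
      using q assms by (simp add: exp_diff exp_add)
    finally have "stolarsky_mean q ?x y
       = exp ((q * (ln y + s) + ln (sinh (q * s) / q) - (ln y + s) - ln (sinh s)) * (1 / (q - 1)))"
      using q ne by (simp add: stolarsky_mean_def exp_powr_real)
    also have "(q * (ln y + s) + ln (sinh (q * s) / q) - (ln y + s) - ln (sinh s)) * (1 / (q - 1))
       = ln y + (s + log_stol q s)"
    proof -
      have num: "q * (ln y + s) + ln (sinh (q * s) / q) - (ln y + s) - ln (sinh s)
         = (q - 1) * (ln y + s) - (ln (sinh s) - ln (sinh (q * s) / q))"
        by (simp add: algebra_simps)
      have quot: "((q - 1) * a - b) * (1 / (q - 1)) = a + b / (1 - q)" for a b
        using assms by (simp add: divide_simps) (simp add: algebra_simps)
      show ?thesis unfolding num quot using q by (simp add: log_stol_def)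
    qed
    finally show ?thesis using assms by (simp add: exp_add)
  qed
qed

lemma ratio_exp:
  assumes "0 < y" "0 < s" "0 \<le> q" "q < 1"
  shows "power_mean p (y * exp (2 * s)) y / stolarsky_mean q (y * exp (2 * s)) y
       = exp (log_pow p s - log_stol q s)"
  using assms by (simp add: power_mean_exp stolarsky_mean_exp exp_add exp_diff)

section \<open>Derivatives and asymptotics of the logarithms\<close>

lemma log_pow_deriv: "(log_pow p has_real_derivative pow_slope p s) (at s)"
proof -
  consider "p = \<infinity>" | "p = -\<infinity>" | "p = 0" | r where "p = ereal r" "r \<noteq> 0"
    by (cases p) (auto simp: zero_ereal_def)
  then show ?thesis
  proof cases
    case 4
    have "((\<lambda>s. ln (cosh (r * s)) / r) has_real_derivative tanh (r * s)) (at s)"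
      using 4 by (auto intro!: derivative_eq_intros simp: tanh_def)
    then show ?thesis using 4 by (simp add: log_pow_def[abs_def] pow_slope_def)
  qed (auto simp: log_pow_def[abs_def] pow_slope_def intro!: derivative_eq_intros)
qed

lemma log_stol_deriv:
  assumes "0 < s" "0 \<le> q" "q < 1"
  shows "(log_stol q has_real_derivative stol_slope q s) (at s)"
proof (cases "q = 0")
  case True
  have "((\<lambda>s. ln (sinh s) - ln s) has_real_derivative cosh s / sinh s - 1 / s) (at s)"
    using assms by (auto intro!: derivative_eq_intros)
  then show ?thesis using True by (simp add: log_stol_def[abs_def] stol_slope_def)
next
  case False
  then have "((\<lambda>s. ln (sinh s) - ln (sinh (q * s) / q)) has_real_derivative
      cosh s / sinh s - q * cosh (q * s) / sinh (q * s)) (at s)"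
    using assms by (auto intro!: derivative_eq_intros)
  then have "((\<lambda>s. (ln (sinh s) - ln (sinh (q * s) / q)) / (1 - q)) has_real_derivative
      (cosh s / sinh s - q * cosh (q * s) / sinh (q * s)) / (1 - q)) (at s)"
    by (rule DERIV_cdivide)
  then show ?thesis using False by (simp add: log_stol_def[abs_def] stol_slope_def)
qed

lemma log_stol_tendsto_0:
  assumes "0 \<le> q"
  shows "(log_stol q \<longlongrightarrow> 0) (at_right 0)"
proof -
  have "((\<lambda>s. ln (sinh s) - ln (if q = 0 then s else sinh (q * s) / q)) \<longlongrightarrow> 0) (at_right (0::real))"
  proof (cases "q = 0")
    case True
    have "((\<lambda>s. ln (sinh s) - ln s) \<longlongrightarrow> 0) (at_right (0::real))" by real_asymp
    then show ?thesis using True by simp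
  next
    case False
    then have "0 < q" using assms by simp
    then have "((\<lambda>s. ln (sinh s) - ln (sinh (q * s) / q)) \<longlongrightarrow> 0) (at_right (0::real))" by real_asymp
    then show ?thesis using False by simp
  qed
  then show ?thesis unfolding log_stol_def[abs_def] by (rule tendsto_divide_zero)
qed

text \<open>Since \<open>coth u = 1/u + u/3 + ...\<close>, the poles cancel in
  \<open>coth s - q coth (q s)\<close> and \<open>(1 - q^2) s / 3\<close> is the leading term. The
  limit is to be compared with \<open>tanh (p * s) / s\<close>, which tends to
  \<open>p\<close>.\<close>

lemma stol_slope_div_tendsto:
  assumes "0 \<le> q" "q < 1"
  shows "((\<lambda>s. stol_slope q s / s) \<longlongrightarrow> (1 + q) / 3) (at_right 0)"
proof (cases "q = 0")
  case True
  have "((\<lambda>s. (cosh s / sinh s - 1 / s) / s) \<longlongrightarrow> 1 / 3) (at_right (0::real))" by real_asymp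
  then show ?thesis using True by (simp add: stol_slope_def)
next
  case False
  then have "0 < q" using assms by simp
  then have "((\<lambda>s. (cosh s / sinh s - q * cosh (q * s) / sinh (q * s)) / s)
      \<longlongrightarrow> 1/3 - q^2/3) (at_right (0::real))"
    by real_asymp (simp add: field_simps power2_eq_square)
  then have "((\<lambda>s. (cosh s / sinh s - q * cosh (q * s) / sinh (q * s)) / s / (1 - q))
      \<longlongrightarrow> (1/3 - q^2/3) / (1 - q)) (at_right (0::real))"
    using assms by (intro tendsto_divide tendsto_const) auto
  moreover have "(1/3 - q^2/3) / (1 - q) = (1 + q) / 3"
    using assms by (simp add: field_simps power2_eq_square)
  ultimately show ?thesis using False by (simp add: stol_slope_def mult.commute)
qed

text \<open>\<open>1 - tanh (p * s)\<close> decays like \<open>2 * exp (- 2 * p * s)\<close>, too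
  slowly for the weight when \<open>p < q\<close>.\<close>

lemma tanh_defect_at_top:
  fixes p q :: real
  assumes "0 < p" "p < q" "q < 1"
  shows "filterlim (\<lambda>s. (1 - tanh (p * s)) * exp (2 * q * s)) at_top at_top"
  using assms by real_asymp

text \<open>\<open>q coth (q s)\<close> exceeds \<open>q\<close> by about
  \<open>2 * q * exp (- 2 * q * s)\<close>, while the excess of \<open>coth s\<close> over 1 is of
  the smaller order \<open>exp (- 2 * s)\<close>.\<close>

lemma stol_slope_defect_tendsto:
  assumes "0 < q" "q < 1"
  shows "((\<lambda>s. (1 - stol_slope q s) * exp (2 * q * s)) \<longlongrightarrow> 2 * q * inverse (1 - q)) at_top"
proof -
  have "((\<lambda>s. (1 - (cosh s / sinh s - q * cosh (q * s) / sinh (q * s)) / (1 - q)) * exp (2 * q * s))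
      \<longlongrightarrow> 2 * q * inverse (1 - q)) at_top"
    using assms by real_asymp
  then show ?thesis using assms by (simp add: stol_slope_def)
qed

section \<open>Hyperbolic inequalities from power series\<close>

text \<open>The \<open>sinh\<close> series has only odd terms, and the assumed quantity times
  \<open>s ^ m / fact m\<close> is the term of degree \<open>m\<close> of the combination.\<close>

lemma sinh_combination_nonneg:
  fixes a b c \<alpha> \<beta> \<gamma> s :: real
  assumes coeff: "\<And>m. odd m \<Longrightarrow> 0 \<le> \<alpha> * a ^ m + \<beta> * b ^ m + \<gamma> * c ^ m" and "0 \<le> s"
  shows "0 \<le> \<alpha> * sinh (a * s) + \<beta> * sinh (b * s) + \<gamma> * sinh (c * s)"
proof -
  define f where "f = (\<lambda>(x::real) m. if even m then 0 else x ^ m /\<^sub>R fact m)"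
  have "f x sums sinh x" for x
    unfolding f_def by (rule sinh_converges)
  then have sums: "(\<lambda>m. \<alpha> * f (a * s) m + \<beta> * f (b * s) m + \<gamma> * f (c * s) m) sums
     (\<alpha> * sinh (a * s) + \<beta> * sinh (b * s) + \<gamma> * sinh (c * s))"
    by (intro sums_add sums_mult)
  have "0 \<le> \<alpha> * f (a * s) m + \<beta> * f (b * s) m + \<gamma> * f (c * s) m" for m
  proof (cases "even m")
    case False
    then have "f (x * s) m = x ^ m * (s ^ m / fact m)" for x
      by (simp add: f_def power_mult_distrib divide_inverse)
    then have "\<alpha> * f (a * s) m + \<beta> * f (b * s) m + \<gamma> * f (c * s) m
        = (\<alpha> * a ^ m + \<beta> * b ^ m + \<gamma> * c ^ m) * (s ^ m / fact m)"
      by (simp only: distrib_right mult.assoc)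
    also have "\<dots> \<ge> 0"
      using coeff[OF False] \<open>0 \<le> s\<close> by (intro mult_nonneg_nonneg) simp_all
    finally show ?thesis .
  qed (simp add: f_def)
  then show ?thesis by (rule sums_le[OF _ sums_zero sums])
qed

text \<open>
  Equality holds for \<open>m = 1\<close> and \<open>m = 3\<close>; the latter is what makes the induction with step 2 work.
\<close>

lemma odd_power_combination_nonneg:
  fixes q :: real
  assumes "0 \<le> q" "q \<le> 1/2" "odd m"
  shows "0 \<le> q * (2 - q) ^ m + 1 * (1 - 2 * q) ^ m + (q - 1) * (1 + q) ^ m"
proof -
  define a b c where "a = 2 - q" and "b = 1 - 2 * q" and "c = 1 + q"
  have ab: "0 \<le> b" "b \<le> a" using assms by (auto simp: a_def b_def)
  \<comment> \<open>The equality for exponent 3 minus \<open>c^2\<close> times the equality for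
    exponent 1.\<close>
  have eq: "q * a * (a^2 - c^2) = b * (c^2 - b^2)"
    by (simp add: a_def b_def c_def power2_eq_square algebra_simps)
  have "c^2 - b^2 = 3 * q * (2 - q)"
    by (simp add: b_def c_def power2_eq_square algebra_simps)
  then have pos: "0 \<le> b * (c^2 - b^2)" using ab assms by simp
  have "0 \<le> q * a ^ (2*k+1) + b ^ (2*k+1) + (q - 1) * c ^ (2*k+1)" for k
  proof (induction k)
    case 0
    show ?case by (simp add: a_def b_def c_def algebra_simps)
  next
    case (Suc k)
    define A B C where "A = a ^ (2*k)" and "B = b ^ (2*k)" and "C = c ^ (2*k)"
    have pow: "a ^ (2*k+1) = A * a" "b ^ (2*k+1) = B * b" "c ^ (2*k+1) = C * c"
        "a ^ (2*Suc k+1) = A * a * a^2" "b ^ (2*Suc k+1) = B * b * b^2" "c ^ (2*Suc k+1) = C * c * c^2"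
      by (simp_all add: A_def B_def C_def power2_eq_square)
    \<comment> \<open>Let \<open>F m\<close> be the combination with exponent \<open>m\<close>. In
      \<open>F (m + 2) - c^2 * F m\<close> the powers of \<open>c\<close> cancel, and by
      \<open>eq\<close> the rest is \<open>(A - B) * b * (c^2 - b^2)\<close> for
      \<open>m = 2 * k + 1\<close>.\<close>
    have "B * (b * (c^2 - b^2)) \<le> A * (b * (c^2 - b^2))"
      unfolding A_def B_def using ab pos by (intro mult_right_mono power_mono) auto
    then have "0 \<le> A * (q * a * (a^2 - c^2)) - B * (b * (c^2 - b^2))"
      by (simp add: eq)
    also have "\<dots> = (q * (A * a * a^2) + B * b * b^2 + (q - 1) * (C * c * c^2))
        - c^2 * (q * (A * a) + B * b + (q - 1) * (C * c))"
      by (simp add: algebra_simps)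
    finally have "c^2 * (q * (A * a) + B * b + (q - 1) * (C * c))
        \<le> q * (A * a * a^2) + B * b * b^2 + (q - 1) * (C * c * c^2)" by simp
    moreover have "0 \<le> c^2 * (q * (A * a) + B * b + (q - 1) * (C * c))"
      using Suc.IH unfolding pow by (intro mult_nonneg_nonneg) auto
    ultimately show ?case unfolding pow by (rule order_trans[rotated])
  qed
  moreover obtain k where "m = 2*k+1" using \<open>odd m\<close> by (auto elim: oddE)
  ultimately show ?thesis unfolding a_def b_def c_def by simp
qed

text \<open>The bracket on the left is \<open>(1 - q) * (tanh (p * s) - stol_slope q s)\<close> with
  the denominators \<open>sinh s\<close>, \<open>sinh (q * s)\<close>, \<open>cosh (p * s)\<close>
  cleared, for \<open>q \<noteq> 0\<close>. Of the four possible frequencies,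
  \<open>1 + q + p\<close> drops out because its coefficients \<open>1 - q\<close>, \<open>q\<close>
  and \<open>-1\<close> add to 0.\<close>

lemma sinh_cosh_product_to_sum:
  fixes p q s :: real
  shows "2 * ((1 - q) * sinh (p * s) * sinh s * sinh (q * s)
      + q * cosh (q * s) * sinh s * cosh (p * s) - cosh s * sinh (q * s) * cosh (p * s))
    = q * sinh ((1 - q + p) * s) + sinh ((1 - q - p) * s) - (1 - q) * sinh ((1 + q - p) * s)"
  by (simp add: ring_distribs sinh_add cosh_add sinh_diff cosh_diff)

section \<open>The slope inequality for sufficiently large order\<close>

lemma stol_slope_le_tanh_if:
  assumes "0 < q" "q < 1" "0 < s"
    and "0 \<le> q * sinh ((1 - q + p) * s) + sinh ((1 - q - p) * s) - (1 - q) * sinh ((1 + q - p) * s)"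
  shows "stol_slope q s \<le> tanh (p * s)"
proof -
  let ?S = "sinh s" and ?C = "cosh s" and ?Sq = "sinh (q * s)" and ?Cq = "cosh (q * s)"
    and ?Sp = "sinh (p * s)" and ?Cp = "cosh (p * s)"
  have pos: "0 < ?S" "0 < ?Sq" "0 < ?Cp" using assms by auto
  have "0 \<le> (1 - q) * ?Sp * ?S * ?Sq + q * ?Cq * ?S * ?Cp - ?C * ?Sq * ?Cp"
    using assms(4) unfolding sinh_cosh_product_to_sum[symmetric] by simp
  then have "0 \<le> ((1 - q) * ?Sp * ?S * ?Sq + q * ?Cq * ?S * ?Cp - ?C * ?Sq * ?Cp) / (?S * ?Sq * ?Cp)"
    using pos by simp
  also have "((1 - q) * f * a * b + q * d * a * c - e * b * c) / (a * b * c)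
      = (1 - q) * (f / c) - (e / a - q * d / b)" if "0 < a" "0 < b" "0 < c" for a b c d e f :: real
    using that by (simp add: divide_simps) (simp add: algebra_simps)
  note this[OF pos]
  finally have "?C / ?S - q * ?Cq / ?Sq \<le> tanh (p * s) * (1 - q)"
    by (simp add: tanh_def mult.commute)
  then show ?thesis using assms by (simp add: stol_slope_def pos_divide_le_eq)
qed

text \<open>For \<open>p = (1 + q) / 3\<close> the three frequencies are \<open>2/3\<close> times
  \<open>2 - q\<close>, \<open>1 - 2 * q\<close> and \<open>1 + q\<close>, so the factor is moved
  into the argument \<open>2 * s / 3\<close>. The bound \<open>q \<le> 1/2\<close> makes
  \<open>1 - 2 * q\<close> nonnegative.\<close>

lemma stol_slope_le_tanh_small:
  assumes "0 < q" "q \<le> 1/2" "0 < s"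
  shows "stol_slope q s \<le> tanh ((1 + q) / 3 * s)"
proof (rule stol_slope_le_tanh_if)
  have "0 \<le> q * sinh ((2 - q) * (2 * s / 3)) + 1 * sinh ((1 - 2 * q) * (2 * s / 3))
      + (q - 1) * sinh ((1 + q) * (2 * s / 3))"
    using assms odd_power_combination_nonneg by (intro sinh_combination_nonneg) auto
  moreover have "(2 - q) * (2 * s / 3) = (1 - q + (1 + q) / 3) * s"
      "(1 - 2 * q) * (2 * s / 3) = (1 - q - (1 + q) / 3) * s"
      "(1 + q) * (2 * s / 3) = (1 + q - (1 + q) / 3) * s"
    by (simp_all add: field_simps)
  moreover have "(q - 1) * X = - ((1 - q) * X)" for X
    by (simp add: algebra_simps)
  ultimately show "0 \<le> q * sinh ((1 - q + (1 + q) / 3) * s) + sinh ((1 - q - (1 + q) / 3) * s)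
      - (1 - q) * sinh ((1 + q - (1 + q) / 3) * s)"
    by (simp only: mult_1 diff_conv_add_uminus)
qed (use assms in auto)

lemma stol_slope_0_le_tanh:
  assumes "0 < s"
  shows "stol_slope 0 s \<le> tanh (1 / 3 * s)"
proof -
  have "((\<lambda>q. q * cosh (q * s) / sinh (q * s)) \<longlongrightarrow> inverse s) (at_right (0::real))"
    using assms by real_asymp
  then have "((\<lambda>q. (cosh s / sinh s - q * cosh (q * s) / sinh (q * s)) / (1 - q))
      \<longlongrightarrow> (cosh s / sinh s - inverse s) / (1 - 0)) (at_right (0::real))"
    by (intro tendsto_intros) auto
  moreover have "((\<lambda>q. tanh ((1 + q) / 3 * s)) \<longlongrightarrow> tanh ((1 + 0) / 3 * s)) (at_right (0::real))"
    by (intro tendsto_intros) auto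
  moreover have "\<forall>\<^sub>F q in at_right (0::real).
      (cosh s / sinh s - q * cosh (q * s) / sinh (q * s)) / (1 - q) \<le> tanh ((1 + q) / 3 * s)"
    using eventually_at_right_real[of 0 "1/2::real", simplified]
  proof eventually_elim
    case (elim q)
    then show ?case using stol_slope_le_tanh_small[of q s] assms by (simp add: stol_slope_def)
  qed
  ultimately have "(cosh s / sinh s - inverse s) / (1 - 0) \<le> tanh ((1 + 0) / 3 * s)"
    by (intro tendsto_le[of "at_right (0::real)"]) auto
  then show ?thesis by (simp add: stol_slope_def inverse_eq_divide)
qed

text \<open>For \<open>p = q\<close> two of the frequencies are 1, and the inequality collapses to
  \<open>sinh (\<theta> * s) \<le> \<theta> * sinh s\<close> with
  \<open>\<theta> = 2 * q - 1\<close> in the unit interval.\<close>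

lemma stol_slope_le_tanh_large:
  assumes "1/2 \<le> q" "q < 1" "0 < s"
  shows "stol_slope q s \<le> tanh (q * s)"
proof (rule stol_slope_le_tanh_if)
  define \<theta> where "\<theta> = 2 * q - 1"
  have \<theta>: "0 \<le> \<theta>" "\<theta> \<le> 1" using assms by (auto simp: \<theta>_def)
  have "0 \<le> \<theta> * sinh (1 * s) + (- 1) * sinh (\<theta> * s) + 0 * sinh (0 * s)"
  proof (intro sinh_combination_nonneg)
    fix m :: nat
    assume "odd m"
    then have "\<theta> ^ m \<le> \<theta>" using \<theta> power_decreasing[of 1 m \<theta>] by (cases m) auto
    then show "0 \<le> \<theta> * 1 ^ m + (- 1) * \<theta> ^ m + 0 * 0 ^ m" by simp
  qed (use assms in simp)
  moreover have "sinh ((1 - q - q) * s) = - sinh (\<theta> * s)"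
    unfolding \<theta>_def by (simp flip: sinh_minus) (simp add: algebra_simps)
  ultimately show "0 \<le> q * sinh ((1 - q + q) * s) + sinh ((1 - q - q) * s)
      - (1 - q) * sinh ((1 + q - q) * s)"
    by (simp add: \<theta>_def algebra_simps)
qed (use assms in auto)

text \<open>The two terms of the maximum cross at \<open>q = 1/2\<close>, which is where the two
  critical cases meet.\<close>

lemma stol_slope_le_tanh:
  assumes "0 \<le> q" "q < 1" "0 < s" "max q ((1 + q) / 3) \<le> p"
  shows "stol_slope q s \<le> tanh (p * s)"
proof -
  have "stol_slope q s \<le> tanh (max q ((1 + q) / 3) * s)"
  proof -
    consider "q = 0" | "0 < q" "q \<le> 1/2" | "1/2 \<le> q" using assms by linarith
    then show ?thesis
      using assms stol_slope_0_le_tanh[of s] stol_slope_le_tanh_small[of q s]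
        stol_slope_le_tanh_large[of q s]
      by cases (auto simp: max_def)
  qed
  also have "\<dots> \<le> tanh (p * s)" using assms by simp
  finally show ?thesis .
qed

lemma stol_slope_le_pow_slope:
  assumes "0 \<le> q" "q < 1" "0 < s" "ereal (max q ((1 + q) / 3)) \<le> p"
  shows "stol_slope q s \<le> pow_slope p s"
proof (cases p)
  case (real r)
  then show ?thesis using assms stol_slope_le_tanh[of q s r] by (simp add: pow_slope_def)
next
  case PInf
  then show ?thesis
    using assms stol_slope_le_tanh[of q s "max q ((1 + q) / 3)"]
      tanh_real_lt_1[of "max q ((1 + q) / 3) * s"]
    by (simp add: pow_slope_def)
qed (use assms in \<open>auto simp: max_def split: if_splits\<close>)

section \<open>Necessity of the bound on the order\<close>

lemma pow_slope_ge_imp_order_ge: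
  assumes "0 \<le> q" "q < 1" and le: "\<And>s. 0 < s \<Longrightarrow> stol_slope q s \<le> pow_slope p s"
  shows "ereal (max q ((1 + q) / 3)) \<le> p"
proof (cases p)
  case MInf
  \<comment> \<open>The Stolarsky slope is positive near 0, but at order \<open>-\<infinity>\<close>
    the power slope is -1.\<close>
  have "\<forall>\<^sub>F s in at_right 0. 0 < stol_slope q s / s"
    using assms by (intro order_tendstoD(1)[OF stol_slope_div_tendsto]) auto
  then have "\<forall>\<^sub>F s in at_right (0::real). False"
    using eventually_at_right_less[of "0::real"]
  proof eventually_elim
    case (elim s)
    then show ?case using le[of s] MInf by (auto simp: pow_slope_def zero_less_divide_iff)
  qed
  then show ?thesis by (simp add: trivial_limit_at_right_real)
next
  case (real r)
  have tanh: "stol_slope q s \<le> tanh (r * s)" if "0 < s" for s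
    using le[OF that] real by (simp add: pow_slope_def)
  have "((\<lambda>s. tanh (r * s) / s) \<longlongrightarrow> r) (at_right (0::real))"
  proof (cases "r = 0")
    case False
    then show ?thesis by real_asymp
  qed simp
  moreover have "\<forall>\<^sub>F s in at_right 0. stol_slope q s / s \<le> tanh (r * s) / s"
    using eventually_at_right_less[of "0::real"]
    by eventually_elim (auto intro!: divide_right_mono tanh)
  ultimately have "(1 + q) / 3 \<le> r"
    using tendsto_le[OF _ _ stol_slope_div_tendsto[OF assms(1,2)]] by simp
  moreover have "q \<le> r"
  proof (rule ccontr)
    assume "\<not> q \<le> r"
    \<comment> \<open>The bound from \<open>s\<close> near 0 already makes \<open>r\<close>
      positive, as the asymptotics of \<open>tanh (r * s)\<close> require.\<close>
    then have *: "0 < r" "r < q" using \<open>(1 + q) / 3 \<le> r\<close> assms by auto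
    \<comment> \<open>Both slopes tend to 1, so the weighted distances from 1 are compared: this one
      stays bounded and the one of \<open>tanh\<close> does not, although it should be the
      smaller.\<close>
    have "\<forall>\<^sub>F s in at_top. (1 - stol_slope q s) * exp (2 * q * s) < 2 * q * inverse (1 - q) + 1"
      using * assms by (intro order_tendstoD(2)[OF stol_slope_defect_tendsto]) auto
    moreover have "\<forall>\<^sub>F s in at_top. 2 * q * inverse (1 - q) + 1 \<le> (1 - tanh (r * s)) * exp (2 * q * s)"
      using tanh_defect_at_top[OF * assms(2)] by (simp add: filterlim_at_top)
    ultimately have "\<forall>\<^sub>F s in (at_top :: real filter). False"
      using eventually_gt_at_top[of "0::real"]
    proof eventually_elim
      case (elim s)
      have "(1 - tanh (r * s)) * exp (2 * q * s) \<le> (1 - stol_slope q s) * exp (2 * q * s)"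
        using tanh elim by (intro mult_right_mono) auto
      then show ?case using elim by linarith
    qed
    then show False by simp
  qed
  ultimately show ?thesis using real by simp
qed simp

section \<open>From slopes to monotonicity of the ratio\<close>

text \<open>The difference of the logarithms has nonnegative derivative for \<open>s > 0\<close> and
  tends to 0 as \<open>s\<close> decreases to 0, hence it is increasing and nonnegative.\<close>

lemma log_stol_le_log_pow:
  assumes "0 \<le> q" "q < 1" "0 < s" and slope: "\<And>s. 0 < s \<Longrightarrow> stol_slope q s \<le> pow_slope p s"
  shows "log_stol q s \<le> log_pow p s"
    and "s \<le> t \<Longrightarrow> log_pow p s - log_stol q s \<le> log_pow p t - log_stol q t"
proof -
  let ?D = "\<lambda>s. log_pow p s - log_stol q s"
  have mono: "?D a \<le> ?D b" if "0 < a" "a \<le> b" for a b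
  proof (rule DERIV_nonneg_imp_nondecreasing[OF \<open>a \<le> b\<close>])
    fix u
    assume "a \<le> u"
    then have "0 < u" using \<open>0 < a\<close> by simp
    then show "\<exists>d. (?D has_real_derivative d) (at u) \<and> 0 \<le> d"
      using assms slope[of u]
      by (intro exI[of _ "pow_slope p u - stol_slope q u"] conjI DERIV_diff
          log_pow_deriv log_stol_deriv) auto
  qed
  then show "s \<le> t \<Longrightarrow> ?D s \<le> ?D t" using \<open>0 < s\<close> by blast
  have "(log_pow p \<longlongrightarrow> log_pow p 0) (at_right 0)"
    using DERIV_isCont[OF log_pow_deriv[of p 0]] by (simp add: isCont_def filterlim_at_split)
  then have "(log_pow p \<longlongrightarrow> 0) (at_right 0)" by simp
  then have "(?D \<longlongrightarrow> 0 - 0) (at_right 0)"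
    by (intro tendsto_diff log_stol_tendsto_0 assms)
  moreover have "\<forall>\<^sub>F a in at_right 0. ?D a \<le> ?D s"
    using eventually_at_right_real[OF \<open>0 < s\<close>] by eventually_elim (auto intro: mono)
  ultimately have "0 - 0 \<le> ?D s"
    by (intro tendsto_upperbound) auto
  then show "log_stol q s \<le> log_pow p s" by simp
qed

lemma obtain_exp_param:
  fixes x y :: real
  assumes "0 < y" "y < x"
  obtains s where "0 < s" "x = y * exp (2 * s)"
proof
  show "0 < ln (x / y) / 2" "x = y * exp (2 * (ln (x / y) / 2))"
    using assms by simp_all
qed

text \<open>The substitution and \<open>exp\<close> are both increasing, so off the diagonal this is
  the derivative criterion for the logarithm of the ratio. The resulting condition is free of
  \<open>y\<close>.\<close>

lemma mono_on_ratio_iff: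
  assumes "0 < y" "0 \<le> q" "q < 1"
  shows "mono_on {y..} (\<lambda>x. power_mean p x y / stolarsky_mean q x y)
      \<longleftrightarrow> (\<forall>s>0. stol_slope q s \<le> pow_slope p s)" (is "mono_on _ ?R \<longleftrightarrow> ?slope")
proof
  assume mono: "mono_on {y..} ?R"
  let ?D = "\<lambda>s. log_pow p s - log_stol q s"
  have "mono_on {0<..} ?D"
  proof (rule mono_onI)
    fix a b :: real
    assume "a \<in> {0<..}" "b \<in> {0<..}" "a \<le> b"
    then have "?R (y * exp (2 * a)) \<le> ?R (y * exp (2 * b))"
      using assms by (intro mono_onD[OF mono]) auto
    then show "?D a \<le> ?D b"
      using assms \<open>a \<in> _\<close> \<open>b \<in> _\<close> by (simp add: ratio_exp)
  qed
  moreover have "(?D has_real_derivative pow_slope p s - stol_slope q s) (at s)" if "0 < s" for s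
    using assms that by (intro DERIV_diff log_pow_deriv log_stol_deriv)
  ultimately have "0 \<le> pow_slope p s - stol_slope q s" if "0 < s" for s
    using mono_on_imp_deriv_nonneg[of "{0<..}" ?D "pow_slope p s - stol_slope q s" s] that
    by (simp add: interior_open)
  then show ?slope by simp
next
  assume slope: ?slope
  show "mono_on {y..} ?R"
  proof (rule mono_onI)
    fix u v
    assume uv: "u \<in> {y..}" "v \<in> {y..}" "u \<le> v"
    \<comment> \<open>\<open>ratio_exp\<close> needs \<open>s > 0\<close>, so the endpoint
      \<open>u = y\<close> is separate: the ratio is 1 there and at least 1 further right.\<close>
    consider "u = v" | "u = y" "y < v" | "y < u" "y < v" using uv by fastforce
    then show "?R u \<le> ?R v"
    proof cases
      case 2
      have "?R y = 1"
        using power_mean_exp[of y 0 p] assms by (simp add: stolarsky_mean_def)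
      moreover obtain s where "0 < s" "v = y * exp (2 * s)"
        using obtain_exp_param assms 2 by blast
      ultimately show ?thesis
        using 2 assms slope log_stol_le_log_pow(1)[of q s p] by (simp add: ratio_exp)
    next
      case 3
      obtain s where "0 < s" "u = y * exp (2 * s)"
        using obtain_exp_param assms 3 by blast
      moreover obtain t where "0 < t" "v = y * exp (2 * t)"
        using obtain_exp_param assms 3 by blast
      ultimately show ?thesis
        using assms slope uv log_stol_le_log_pow(2)[of q s p t] by (simp add: ratio_exp)
    qed simp
  qed
qed

section \<open>Comparison of the means on the closed quadrant\<close>

lemma power_mean_commute: "power_mean p x y = power_mean p y x"
  by (auto simp: power_mean_def max.commute min.commute mult.commute add.commute)

lemma stolarsky_mean_commute: "stolarsky_mean q x y = stolarsky_mean q y x"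
proof -
  have "(x - y) / (ln x - ln y) = (y - x) / (ln y - ln x)"
    using minus_divide_divide[of "x - y" "ln x - ln y"] by simp
  moreover have "(x powr q - y powr q) / (q * (x - y)) = (y powr q - x powr q) / (q * (y - x))"
    using minus_divide_divide[of "x powr q - y powr q" "q * (x - y)"] by (simp flip: mult_minus_right)
  ultimately show ?thesis by (auto simp: stolarsky_mean_def log_mean_def)
qed

lemma stolarsky_mean_le_power_mean_pos:
  assumes "0 \<le> q" "q < 1" "ereal (max q ((1 + q) / 3)) \<le> p" "0 < y" "y < x"
  shows "stolarsky_mean q x y \<le> power_mean p x y"
proof -
  obtain s where s: "0 < s" "x = y * exp (2 * s)"
    using obtain_exp_param assms by blast
  have "log_stol q s \<le> log_pow p s"
    using assms s by (intro log_stol_le_log_pow(1) stol_slope_le_pow_slope)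
  then show ?thesis using s assms by (simp add: power_mean_exp stolarsky_mean_exp)
qed

text \<open>For \<open>q > 0\<close> the value \<open>0 powr q = 0\<close> agrees with the limit of
  \<open>y powr q\<close>, so the inequality for positive arguments can be carried over to the
  boundary.\<close>

lemma stolarsky_mean_tendsto_0:
  assumes "0 < q" "q < 1" "0 < x"
  shows "(stolarsky_mean q x \<longlongrightarrow> stolarsky_mean q x 0) (at_right 0)"
proof -
  have "((\<lambda>y. y powr q) \<longlongrightarrow> 0) (at_right (0::real))" using \<open>0 < q\<close> by real_asymp
  then have "((\<lambda>y. ((x powr q - y powr q) / (q * (x - y))) powr (1 / (q - 1))) \<longlongrightarrow>
      ((x powr q - 0) / (q * (x - 0))) powr (1 / (q - 1))) (at_right 0)"
    using assms by (intro tendsto_intros) auto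
  moreover have "\<forall>\<^sub>F y in at_right 0.
      stolarsky_mean q x y = ((x powr q - y powr q) / (q * (x - y))) powr (1 / (q - 1))"
    using eventually_at_right_real[OF \<open>0 < x\<close>]
    by eventually_elim (use assms in \<open>auto simp: stolarsky_mean_def\<close>)
  ultimately show ?thesis using assms by (simp add: tendsto_cong stolarsky_mean_def)
qed

lemma power_mean_tendsto_0:
  assumes "0 < p" "0 < x"
  shows "(power_mean p x \<longlongrightarrow> power_mean p x 0) (at_right 0)"
proof (cases p)
  case (real r)
  then have "0 < r" using assms by simp
  then have "((\<lambda>y. y powr r) \<longlongrightarrow> 0) (at_right (0::real))" by real_asymp
  then have "((\<lambda>y. ((x powr r + y powr r) / 2) powr (1 / r)) \<longlongrightarrow>
      ((x powr r + 0) / 2) powr (1 / r)) (at_right 0)"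
    using assms by (intro tendsto_intros) auto
  then show ?thesis using real \<open>0 < r\<close> by (simp add: power_mean_def[abs_def])
next
  case PInf
  have "((\<lambda>y. max x y) \<longlongrightarrow> max x 0) (at_right 0)" by (intro tendsto_intros)
  then show ?thesis using PInf by (simp add: power_mean_def[abs_def])
qed (use assms in simp)

text \<open>For \<open>q = 0\<close> the left side is 0 by definition. For \<open>q > 0\<close> the
  inequality at \<open>y > 0\<close> passes to the limit, the order \<open>p\<close> being
  positive.\<close>

lemma stolarsky_mean_le_power_mean_0:
  assumes "0 \<le> q" "q < 1" "ereal (max q ((1 + q) / 3)) \<le> p" "0 < x"
  shows "stolarsky_mean q x 0 \<le> power_mean p x 0"
proof (cases "q = 0")
  case True
  then show ?thesis using assms by (simp add: stolarsky_mean_def log_mean_def power_mean_def)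
next
  case False
  have "0 < ereal (max q ((1 + q) / 3))" using assms by (simp add: zero_ereal_def max_def)
  then have "0 < p" using assms(3) by (rule less_le_trans)
  have "\<forall>\<^sub>F y in at_right 0. stolarsky_mean q x y \<le> power_mean p x y"
    using eventually_at_right_real[OF \<open>0 < x\<close>]
    by eventually_elim (use assms stolarsky_mean_le_power_mean_pos in auto)
  then show ?thesis
    using False assms \<open>0 < p\<close>
    by (intro tendsto_le[OF _ power_mean_tendsto_0 stolarsky_mean_tendsto_0]) auto
qed

lemma stolarsky_mean_le_power_mean:
  assumes "0 \<le> q" "q < 1" "ereal (max q ((1 + q) / 3)) \<le> p" "0 \<le> x" "0 \<le> y"
  shows "stolarsky_mean q x y \<le> power_mean p x y"
proof -
  have ordered: "stolarsky_mean q a b \<le> power_mean p a b" if "0 \<le> b" "b < a" for a b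
    using assms that stolarsky_mean_le_power_mean_pos[of q p b a] stolarsky_mean_le_power_mean_0[of q p a]
    by (cases "b = 0") auto
  consider "y < x" | "x < y" | "x = y" by linarith
  then show ?thesis
  proof cases
    case 2
    then show ?thesis using ordered[of x y] assms
      by (simp add: power_mean_commute[of p x] stolarsky_mean_commute[of q x])
  next
    case 3
    show ?thesis
    proof (cases "y = 0")
      case True
      then show ?thesis using 3 by (simp add: stolarsky_mean_def power_mean_def)
    next
      case False
      \<comment> \<open>The case \<open>s = 0\<close> of \<open>power_mean_exp\<close> gives the
        value \<open>y\<close> on the diagonal.\<close>
      then show ?thesis
        using 3 assms power_mean_exp[of y 0 p] by (simp add: stolarsky_mean_def)
    qed
  qed (use ordered assms in auto)
qed

theorem corollary4p1:
  fixes q :: real and p :: ereal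
  assumes "0 \<le> q" and "q < 1"
  shows "(\<forall>y>0. mono_on {y..} (\<lambda>x. power_mean p x y / stolarsky_mean q x y)
                  \<longleftrightarrow> p \<ge> ereal (max q ((1 + q) / 3)))
       \<and> (p \<ge> ereal (max q ((1 + q) / 3)) \<longrightarrow>
            (\<forall>x\<ge>0. \<forall>y\<ge>0. power_mean p x y \<ge> stolarsky_mean q x y))"
proof -
  have "(\<forall>s>0. stol_slope q s \<le> pow_slope p s) \<longleftrightarrow> ereal (max q ((1 + q) / 3)) \<le> p"
    using assms stol_slope_le_pow_slope pow_slope_ge_imp_order_ge by blast
  then show ?thesis
    using assms mono_on_ratio_iff stolarsky_mean_le_power_mean by blast
qed

end
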